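(* Let $\mathcal{R}$ be a commutative ring containing $\mathbb{Q}$, let $\phi(x)=\sum_{k\ge0}\phi[k]\frac{x^k}{k!}\in\mathcal{R}[[x]]$, let $n\ge1$, and let $\mathcal{T}_n^{\phi}(\mathbf{x},\mathbf{q})=\Delta_n^{\phi,q}x_0$. Then $\mathcal{T}_n^{\phi}(\mathbf{x},\mathbf{q})=\mathcal{T}_n^\phi(x_1,\dots,x_n;q_0,\dots,q_{n-1})$ enumerates the $\phi$-enriched increasing trees with $n$ internal vertices by the heights of their leaves and of their internal vertices. That is, for every colored set $(V,\kappa)$ with $\kappa:V\to\{1,\dots,n\}$, the coefficient $\mathcal{T}_n^\phi[V,\kappa](\mathbf{q})$ of $\frac{x_1^{k_1}\cdots x_n^{k_n}}{k_1!\cdots k_n!}$, $k_i=|\kappa^{-1}(i)|$, is the polynomial in $q_0,\dots,q_{n-1}$ given by $$\mathcal{T}_n^\phi[V,\kappa](\mathbf{q})=\sum_T\ \prod_{v\in[n]}\phi\big[\,|T^{-1}(v)|\,\big]\,q_{\mathrm{ht}(v)},$$ where $T$ ranges over the increasing trees with set of internal vertices $[n]$ and set of leaves $V$, each leaf $v\in V$ having height $\kappa(v)$. In particular the coefficient of $q_0q_1^{j_1}\cdots q_{n-1}^{j_{n-1}}$ in $\mathcal{T}_n^\phi[V,\kappa](\mathbf{q})$ is the ($\phi$-weighted) number of those trees having $j_r$ internal vertices of height $r$, $r=1,\dots,n-1$.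
   Context: With $\partial_k=\partial/\partial x_k$ and parameters $q_0,q_1,\dots$, put $\mathcal{D}_m^{\phi,q}=\sum_{k=0}^{m-1}\phi(x_{k+1})\,q_k\,\partial_k$ and $\Delta_n^{\phi,q}=\mathcal{D}_n^{\phi,q}\mathcal{D}_{n-1}^{\phi,q}\cdots\mathcal{D}_1^{\phi,q}$. An increasing tree with set of internal vertices $[n]=\{1,\dots,n\}$ and set of leaves $V$ is a (non-plane) rooted tree on the vertex set $[n]\uplus V$ whose root is in $[n]$, in which the elements of $V$ have no children, and such that the labels of internal vertices increase along each path from the root. (Internal vertices are a distinguished sort of vertex and may have no children; such a vertex contributes the factor $\phi[0]$.) $T^{-1}(v)$ is the set of children (internal vertices and leaves) of $v$; $\mathrm{ht}(v)$ is the distance of $v$ to the root. *)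

theory Defs
  imports
    "HOL-Library.Poly_Mapping"
    "HOL-Computational_Algebra.Formal_Power_Series"
begin

text \<open>
  Monomials in \<open>x\<^sub>0, x\<^sub>1, \<dots>\<close> are finitely supported exponent vectors
  \<^typ>\<open>nat \<Rightarrow>\<^sub>0 nat\<close>.  A formal power series in these variables is an arbitrary family of
  coefficients indexed by monomials, multiplied by the Cauchy product.
\<close>

typedef 'c mfps = "UNIV :: ((nat \<Rightarrow>\<^sub>0 nat) \<Rightarrow> 'c) set"
  morphisms mfps_nth Abs_mfps
  by simp

lemma mfps_nth_Abs [simp]: "mfps_nth (Abs_mfps f) = f"
  by (simp add: Abs_mfps_inverse)

lemma mfps_eqI: "(\<And>m. mfps_nth F m = mfps_nth G m) \<Longrightarrow> F = G"
  by (metis ext mfps_nth_inject)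

definition splittings :: "(nat \<Rightarrow>\<^sub>0 nat) \<Rightarrow> ((nat \<Rightarrow>\<^sub>0 nat) \<times> (nat \<Rightarrow>\<^sub>0 nat)) set" where
  "splittings m = {(a, b). a + b = m}"

lemma finite_splittings [simp]: "finite (splittings m)"
proof -
  let ?S = "{a. \<exists>b. a + b = m}"
  let ?A = "Poly_Mapping.keys m"
  let ?B = "{..(\<Sum>i\<in>?A. Poly_Mapping.lookup m i)}"
  have "Poly_Mapping.lookup ` ?S \<subseteq> {f. \<forall>i. (i \<in> ?A \<longrightarrow> f i \<in> ?B) \<and> (i \<notin> ?A \<longrightarrow> f i = 0)}"
  proof (clarify, intro conjI impI)
    fix a b :: "nat \<Rightarrow>\<^sub>0 nat" and i
    show "Poly_Mapping.lookup a i \<in> {..(\<Sum>i\<in>Poly_Mapping.keys (a + b). Poly_Mapping.lookup (a + b) i)}"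
      if "i \<in> Poly_Mapping.keys (a + b)"
    proof -
      have "Poly_Mapping.lookup a i \<le> Poly_Mapping.lookup (a + b) i"
        by (simp add: lookup_add)
      also have "\<dots> \<le> (\<Sum>i\<in>Poly_Mapping.keys (a + b). Poly_Mapping.lookup (a + b) i)"
        using that by (intro member_le_sum) auto
      finally show ?thesis by simp
    qed
    show "Poly_Mapping.lookup a i = 0" if "i \<notin> Poly_Mapping.keys (a + b)"
      using that by (simp add: in_keys_iff lookup_add)
  qed
  moreover have "finite {f. \<forall>i. (i \<in> ?A \<longrightarrow> f i \<in> ?B) \<and> (i \<notin> ?A \<longrightarrow> f i = 0)}"
    by (rule finite_set_of_finite_funs) auto
  ultimately have "finite (Poly_Mapping.lookup ` ?S)"
    by (rule finite_subset)
  then have "finite ?S"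
    by (rule finite_imageD) (simp add: inj_on_def poly_mapping_eqI)
  then have "finite ((\<lambda>a. (a, m - a)) ` ?S)"
    by simp
  moreover have "splittings m \<subseteq> (\<lambda>a. (a, m - a)) ` ?S"
    by (auto simp: splittings_def image_iff)
  ultimately show ?thesis
    by (rule finite_subset[rotated])
qed

instantiation mfps :: (comm_ring_1) comm_ring_1
begin

definition zero_mfps :: "'a mfps" where
  "0 = Abs_mfps (\<lambda>_. 0)"

definition one_mfps :: "'a mfps" where
  "1 = Abs_mfps (\<lambda>m. if m = 0 then 1 else 0)"

definition plus_mfps :: "'a mfps \<Rightarrow> 'a mfps \<Rightarrow> 'a mfps" where
  "F + G = Abs_mfps (\<lambda>m. mfps_nth F m + mfps_nth G m)"

definition minus_mfps :: "'a mfps \<Rightarrow> 'a mfps \<Rightarrow> 'a mfps" where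
  "F - G = Abs_mfps (\<lambda>m. mfps_nth F m - mfps_nth G m)"

definition uminus_mfps :: "'a mfps \<Rightarrow> 'a mfps" where
  "- F = Abs_mfps (\<lambda>m. - mfps_nth F m)"

definition times_mfps :: "'a mfps \<Rightarrow> 'a mfps \<Rightarrow> 'a mfps" where
  "F * G = Abs_mfps (\<lambda>m. \<Sum>(a, b)\<in>splittings m. mfps_nth F a * mfps_nth G b)"

instance
proof
  fix F G H :: "'a mfps"
  show "F + G + H = F + (G + H)" "F + G = G + F" "0 + F = F" "- F + F = 0" "F - G = F + - G"
    by (auto intro!: mfps_eqI
        simp: plus_mfps_def zero_mfps_def uminus_mfps_def minus_mfps_def algebra_simps)
  show "(0 :: 'a mfps) \<noteq> 1"
  proof
    assume "(0 :: 'a mfps) = 1"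
    then have "mfps_nth (0 :: 'a mfps) 0 = mfps_nth 1 0" by simp
    then show False by (simp add: zero_mfps_def one_mfps_def)
  qed
  show "(F + G) * H = F * H + G * H"
    by (rule mfps_eqI)
      (simp add: times_mfps_def plus_mfps_def case_prod_unfold algebra_simps sum.distrib)
  show "F * G = G * F"
    by (rule mfps_eqI, simp add: times_mfps_def)
      (rule sum.reindex_bij_witness[of _ prod.swap prod.swap];
        auto simp: splittings_def algebra_simps)
  show "1 * F = F"
  proof (rule mfps_eqI)
    fix m
    have "mfps_nth (1 * F) m =
        (\<Sum>(a, b)\<in>splittings m. if a = 0 then mfps_nth F b else 0)"
      by (auto simp: times_mfps_def one_mfps_def case_prod_unfold intro!: sum.cong)
    also have "\<dots> = (\<Sum>(a, b)\<in>{(0 :: nat \<Rightarrow>\<^sub>0 nat, m)}. if a = 0 then mfps_nth F b else 0)"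
      by (rule sum.mono_neutral_right[OF finite_splittings])
        (auto simp: splittings_def split: if_splits)
    finally show "mfps_nth (1 * F) m = mfps_nth F m" by simp
  qed
  show "F * G * H = F * (G * H)"
  proof (rule mfps_eqI)
    fix m
    have "mfps_nth (F * G * H) m =
        (\<Sum>p\<in>splittings m. \<Sum>q\<in>splittings (fst p).
           mfps_nth F (fst q) * mfps_nth G (snd q) * mfps_nth H (snd p))"
      by (simp add: times_mfps_def case_prod_unfold sum_distrib_right)
    also have "\<dots> = (\<Sum>(p, q)\<in>(SIGMA p:splittings m. splittings (fst p)).
           mfps_nth F (fst q) * mfps_nth G (snd q) * mfps_nth H (snd p))"
      by (rule sum.Sigma) auto
    also have "\<dots> = (\<Sum>(p, q)\<in>(SIGMA p:splittings m. splittings (snd p)).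
           mfps_nth F (fst p) * (mfps_nth G (fst q) * mfps_nth H (snd q)))"
      by (rule sum.reindex_bij_witness
          [of _ "\<lambda>((a, u), (b, c)). ((a + b, c), (a, b))" "\<lambda>((u, c), (a, b)). ((a, b + c), (b, c))"])
        (auto simp: splittings_def algebra_simps)
    also have "\<dots> = (\<Sum>p\<in>splittings m. \<Sum>q\<in>splittings (snd p).
           mfps_nth F (fst p) * (mfps_nth G (fst q) * mfps_nth H (snd q)))"
      by (rule sum.Sigma[symmetric]) auto
    also have "\<dots> = mfps_nth (F * (G * H)) m"
      by (simp add: times_mfps_def case_prod_unfold sum_distrib_left)
    finally show "mfps_nth (F * G * H) m = mfps_nth (F * (G * H)) m" .
  qed
qed

end

definition mfps_const :: "'c::comm_ring_1 \<Rightarrow> 'c mfps" where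
  "mfps_const c = Abs_mfps (\<lambda>m. if m = 0 then c else 0)"

definition mfps_var :: "nat \<Rightarrow> 'c::comm_ring_1 mfps" where
  "mfps_var i = Abs_mfps (\<lambda>m. if m = Poly_Mapping.single i 1 then 1 else 0)"

definition mfps_pderiv :: "nat \<Rightarrow> 'c::comm_ring_1 mfps \<Rightarrow> 'c mfps" where
  "mfps_pderiv i F = Abs_mfps (\<lambda>m. of_nat (Suc (Poly_Mapping.lookup m i))
     * mfps_nth F (m + Poly_Mapping.single i 1))"

text \<open>The series \<open>f(x\<^sub>i)\<close> for a univariate series \<open>f\<close>.\<close>

definition fps_at :: "nat \<Rightarrow> 'c::comm_ring_1 fps \<Rightarrow> 'c mfps" where
  "fps_at i f = Abs_mfps (\<lambda>m.
     if m = Poly_Mapping.single i (Poly_Mapping.lookup m i)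
     then fps_nth f (Poly_Mapping.lookup m i) else 0)"

text \<open>The coefficient of \<open>\<Prod>\<^sub>i x\<^sub>i\<^bsup>m\<^sub>i\<^esup> / m\<^sub>i!\<close>.\<close>

definition egf_coeff :: "'c::comm_ring_1 mfps \<Rightarrow> (nat \<Rightarrow>\<^sub>0 nat) \<Rightarrow> 'c" where
  "egf_coeff F m =
     of_nat (\<Prod>i\<in>Poly_Mapping.keys m. fact (Poly_Mapping.lookup m i)) * mfps_nth F m"

text \<open>The polynomial ring \<open>R[q\<^sub>0, q\<^sub>1, \<dots>]\<close>.\<close>

type_synonym 'a qpoly = "(nat \<Rightarrow>\<^sub>0 nat) \<Rightarrow>\<^sub>0 'a"

definition q_var :: "nat \<Rightarrow> 'a::comm_ring_1 qpoly" where
  "q_var k = Poly_Mapping.single (Poly_Mapping.single k 1) 1"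

definition q_const :: "'a::comm_ring_1 \<Rightarrow> 'a qpoly" where
  "q_const c = Poly_Mapping.single 0 c"

text \<open>\<open>\<phi>[k]\<close>, where \<open>\<phi>(x) = \<Sum>\<^sub>k \<phi>[k] x\<^sup>k / k!\<close>.\<close>

definition fps_egf_coeff :: "'a::comm_ring_1 fps \<Rightarrow> nat \<Rightarrow> 'a" where
  "fps_egf_coeff \<phi> k = of_nat (fact k) * fps_nth \<phi> k"

definition D_op :: "'a::comm_ring_1 fps \<Rightarrow> nat \<Rightarrow> 'a qpoly mfps \<Rightarrow> 'a qpoly mfps" where
  "D_op \<phi> m F = (\<Sum>k<m. fps_at (Suc k) (Abs_fps (\<lambda>j. q_const (fps_nth \<phi> j)))
     * mfps_const (q_var k) * mfps_pderiv k F)"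

fun Delta_op :: "'a::comm_ring_1 fps \<Rightarrow> nat \<Rightarrow> 'a qpoly mfps \<Rightarrow> 'a qpoly mfps" where
  "Delta_op \<phi> 0 F = F"
| "Delta_op \<phi> (Suc n) F = D_op \<phi> (Suc n) (Delta_op \<phi> n F)"

definition T_series :: "'a::comm_ring_1 fps \<Rightarrow> nat \<Rightarrow> 'a qpoly mfps" where
  "T_series \<phi> n = Delta_op \<phi> n (mfps_var 0)"

text \<open>
  A rooted tree on the vertex set \<open>W\<close> is given by its root \<open>r\<close> and its set \<open>E\<close> of pairs
  (parent, child).
\<close>

definition rooted_tree :: "'w set \<Rightarrow> 'w \<Rightarrow> ('w \<times> 'w) set \<Rightarrow> bool" where
  "rooted_tree W r E \<longleftrightarrow>
     r \<in> W \<and> E \<subseteq> W \<times> W \<and>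
     (\<forall>u. (u, r) \<notin> E) \<and>
     (\<forall>w\<in>W - {r}. \<exists>!u. (u, w) \<in> E) \<and>
     (\<forall>w\<in>W. (r, w) \<in> E\<^sup>*)"

definition children :: "'w \<times> ('w \<times> 'w) set \<Rightarrow> 'w \<Rightarrow> 'w set" where
  "children T v = {w. (v, w) \<in> snd T}"

definition height :: "'w \<times> ('w \<times> 'w) set \<Rightarrow> 'w \<Rightarrow> nat" where
  "height T v = (LEAST d. (fst T, v) \<in> snd T ^^ d)"

text \<open>
  In the vertex set \<open>[n] \<uplus> V\<close>, internal vertices are tagged by \<^term>\<open>Inl\<close> and leaves by
  \<^term>\<open>Inr\<close>.  An internal vertex may be childless.
\<close>

definition increasing_trees ::
  "nat \<Rightarrow> 'v set \<Rightarrow> ((nat + 'v) \<times> ((nat + 'v) \<times> (nat + 'v)) set) set" where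
  "increasing_trees n V = {(r, E).
     rooted_tree ({1..n} <+> V) r E \<and>
     r \<in> Inl ` {1..n} \<and>
     (\<forall>v\<in>V. children (r, E) (Inr v) = {}) \<and>
     (\<forall>i j. (Inl i, Inl j) \<in> E\<^sup>+ \<longrightarrow> i < j)}"

definition colored_increasing_trees ::
  "nat \<Rightarrow> 'v set \<Rightarrow> ('v \<Rightarrow> nat) \<Rightarrow> ((nat + 'v) \<times> ((nat + 'v) \<times> (nat + 'v)) set) set" where
  "colored_increasing_trees n V \<kappa> =
     {T \<in> increasing_trees n V. \<forall>v\<in>V. height T (Inr v) = \<kappa> v}"

text \<open>The exponent vector of \<open>x\<^sub>1\<^bsup>k\<^sub>1\<^esup> \<cdots> x\<^sub>n\<^bsup>k\<^sub>n\<^esup>\<close> with \<open>k\<^sub>i = |\<kappa>\<^bsup>-1\<^esup>(i)|\<close>.\<close>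

definition color_monom :: "nat \<Rightarrow> 'v set \<Rightarrow> ('v \<Rightarrow> nat) \<Rightarrow> (nat \<Rightarrow>\<^sub>0 nat)" where
  "color_monom n V \<kappa> = (\<Sum>i=1..n. Poly_Mapping.single i (card {v \<in> V. \<kappa> v = i}))"

definition T_coeff ::
  "'a::comm_ring_1 fps \<Rightarrow> nat \<Rightarrow> 'v set \<Rightarrow> ('v \<Rightarrow> nat) \<Rightarrow> 'a qpoly" where
  "T_coeff \<phi> n V \<kappa> = egf_coeff (T_series \<phi> n) (color_monom n V \<kappa>)"

end

(*
  Both the operators D_m and the extraction of a coefficient x_1^{k_1} ... x_n^{k_n} / k_1! ... k_n!
  act by partial derivatives.  Applying a derivative d_k to a product of factors phi^{(c)}(x_{h+1}),
  one for each internal vertex of height h with c children, picks by the Leibniz rule a vertex of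
  height k - 1 and gives it one more child: in D_m the new child is the internal vertex m, which
  contributes q_k phi(x_{k+1}); in the extraction of coefficients it is a leaf of colour k.
*)
theory Submission
  imports Defs
begin

text \<open>The variable x_0 is only a seed: D_1 turns it into q_0 phi(x_1), the contribution of the
  root, and from then on every variable has index at least 1. The shift between a height h and the
  variable x_{h+1} records where the children of a vertex lie. A product of derivatives of phi
  remembers only how many children each vertex has, so the choices made by the Leibniz rule are kept
  in two functions: \<open>p\<close>, the parent of each internal vertex other than the root, and
  \<open>\<pi>\<close>, the parent of each leaf. A new internal vertex chooses among smaller labels
  only, so later choices never alter a height already fixed. Leaves are labelled and attached one at
  a time, which is why the factorials in the coefficients leave no trace in the sum. It then remains
  to match the pairs \<open>(p, \<pi>)\<close> with trees given as sets of edges, whose heights are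
  least lengths of paths.\<close>

lemma sum_PiE_insert:
  assumes "x \<notin> S"
  shows "(\<Sum>f\<in>PiE (insert x S) T. g f) = (\<Sum>f\<in>PiE S T. \<Sum>y\<in>T x. g (f(x := y)))"
proof -
  have "(\<Sum>f\<in>PiE (insert x S) T. g f) = (\<Sum>(y, f)\<in>T x \<times> PiE S T. g (f(x := y)))"
    unfolding PiE_insert_eq
    by (subst sum.reindex[OF inj_combinator[OF assms]]) (simp add: case_prod_unfold)
  also have "\<dots> = (\<Sum>y\<in>T x. \<Sum>f\<in>PiE S T. g (f(x := y)))"
    by (simp add: sum.cartesian_product)
  finally show ?thesis
    by (simp add: sum.swap[of _ "T x"])
qed

section \<open>Power series\<close>

lemma mfps_nth_zero [simp]: "mfps_nth 0 m = 0"
  by (simp add: zero_mfps_def)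

lemma mfps_nth_one: "mfps_nth 1 m = (if m = 0 then 1 else 0)"
  by (simp add: one_mfps_def)

lemma mfps_nth_add [simp]: "mfps_nth (F + G) m = mfps_nth F m + mfps_nth G m"
  by (simp add: plus_mfps_def)

lemma mfps_nth_sum: "mfps_nth (\<Sum>i\<in>I. F i) m = (\<Sum>i\<in>I. mfps_nth (F i) m)"
  by (induction I rule: infinite_finite_induct) auto

lemma mfps_nth_mult:
  "mfps_nth (F * G) m = (\<Sum>(a, b)\<in>splittings m. mfps_nth F a * mfps_nth G b)"
  by (simp add: times_mfps_def)

lemma mfps_nth_pderiv: "mfps_nth (mfps_pderiv i F) m =
    of_nat (Suc (Poly_Mapping.lookup m i)) * mfps_nth F (m + Poly_Mapping.single i 1)"
  by (simp add: mfps_pderiv_def)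

lemma mfps_nth_const_mult [simp]: "mfps_nth (mfps_const c * F) m = c * mfps_nth F m"
proof -
  have "mfps_nth (mfps_const c * F) m =
      (\<Sum>(a, b)\<in>splittings m. if a = 0 then c * mfps_nth F b else 0)"
    by (auto simp: mfps_nth_mult mfps_const_def case_prod_unfold intro!: sum.cong)
  also have "\<dots> = (\<Sum>(a, b)\<in>{(0 :: nat \<Rightarrow>\<^sub>0 nat, m)}. if a = 0 then c * mfps_nth F b else 0)"
    by (rule sum.mono_neutral_right[OF finite_splittings])
      (auto simp: splittings_def split: if_splits)
  finally show ?thesis by simp
qed

lemma mfps_const_mult: "mfps_const (c * d) = mfps_const c * mfps_const d"
  by (rule mfps_eqI, subst mfps_nth_const_mult) (simp add: mfps_const_def)

section \<open>Formal partial derivatives and the Leibniz rule\<close>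

lemma mfps_pderiv_add: "mfps_pderiv i (F + G) = mfps_pderiv i F + mfps_pderiv i G"
  by (rule mfps_eqI) (simp add: mfps_nth_pderiv algebra_simps)

lemma mfps_pderiv_zero [simp]: "mfps_pderiv i 0 = 0"
  by (rule mfps_eqI) (simp add: mfps_nth_pderiv)

lemma single_add_neq_0: "m + Poly_Mapping.single i (1::nat) \<noteq> 0"
proof
  assume "m + Poly_Mapping.single i 1 = 0"
  then have "Poly_Mapping.lookup (m + Poly_Mapping.single i 1) i = 0" by simp
  then show False by (simp add: lookup_add)
qed

lemma mfps_pderiv_one [simp]: "mfps_pderiv i 1 = 0"
  by (rule mfps_eqI) (simp add: mfps_nth_pderiv mfps_nth_one single_add_neq_0[simplified])

lemma mfps_pderiv_sum: "mfps_pderiv i (\<Sum>j\<in>J. F j) = (\<Sum>j\<in>J. mfps_pderiv i (F j))"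
  by (induction J rule: infinite_finite_induct) (auto simp: mfps_pderiv_add)

lemma mfps_pderiv_const_mult:
  "mfps_pderiv i (mfps_const c * F) = mfps_const c * mfps_pderiv i F"
  by (rule mfps_eqI) (simp add: mfps_nth_pderiv mult.left_commute del: of_nat_Suc)

text \<open>Subtraction of exponents is truncated at 0, so it can be undone only where
  \<open>i\<close> occurs in \<open>m\<close>.\<close>

lemma minus_single_add:
  fixes m :: "nat \<Rightarrow>\<^sub>0 nat"
  assumes "Poly_Mapping.lookup m i \<noteq> 0"
  shows "m - Poly_Mapping.single i 1 + Poly_Mapping.single i 1 = m"
  using assms
  by (intro poly_mapping_eqI) (auto simp: lookup_add lookup_minus lookup_single when_def)

text \<open>One half of the Leibniz rule. The weight kills the splittings in which x_i does not
  occur in the left part; lowering that exponent by one turns the others into the splittings of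
  \<open>m\<close>.\<close>

lemma sum_splittings_lookup_fst:
  "(\<Sum>(a, b)\<in>splittings (m + Poly_Mapping.single i 1).
      of_nat (Poly_Mapping.lookup a i) * (mfps_nth F a * mfps_nth G b)) =
    mfps_nth (mfps_pderiv i F * G) m"
proof -
  let ?e = "Poly_Mapping.single i (1::nat)"
  have "(\<Sum>(a, b)\<in>splittings (m + ?e).
      of_nat (Poly_Mapping.lookup a i) * (mfps_nth F a * mfps_nth G b)) =
      (\<Sum>(a, b)\<in>{(a, b) \<in> splittings (m + ?e). Poly_Mapping.lookup a i \<noteq> 0}.
      of_nat (Poly_Mapping.lookup a i) * (mfps_nth F a * mfps_nth G b))"
    by (rule sum.mono_neutral_right) (auto intro!: gr0I)
  also have "\<dots> = (\<Sum>(a, b)\<in>splittings m.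
      of_nat (Suc (Poly_Mapping.lookup a i)) * (mfps_nth F (a + ?e) * mfps_nth G b))"
  proof (rule sum.reindex_bij_witness
      [of _ "\<lambda>(a, b). (a + ?e, b)" "\<lambda>(a, b). (a - ?e, b)"], goal_cases)
    case (1 x)
    then obtain a b where x: "x = (a, b)" "Poly_Mapping.lookup a i \<noteq> 0" by auto
    have "a - ?e + ?e = a" by (rule minus_single_add[OF x(2)])
    then show ?case using x by simp
  next
    case (2 x)
    then obtain a b where x: "x = (a, b)" "Poly_Mapping.lookup a i \<noteq> 0" "a + b = m + ?e"
      by (auto simp: splittings_def)
    have "a - ?e + ?e = a" by (rule minus_single_add[OF x(2)])
    then have "(a - ?e + b) + ?e = m + ?e" using x(3) by (metis add.assoc add.commute)
    then show ?case using x by (simp add: splittings_def)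
  next
    case (5 x)
    then obtain a b where x: "x = (a, b)" "Poly_Mapping.lookup a i \<noteq> 0" by auto
    have "a - ?e + ?e = a" by (rule minus_single_add[OF x(2)])
    then show ?case using x by (simp add: lookup_minus)
  qed (auto simp: splittings_def lookup_add algebra_simps)
  also have "\<dots> = mfps_nth (mfps_pderiv i F * G) m"
    by (simp add: mfps_nth_mult mfps_nth_pderiv mult.assoc)
  finally show ?thesis .
qed

text \<open>The factor m_i + 1 produced by the derivative is the exponent of x_i in the product
  monomial, hence the sum of its exponents in the two parts of any splitting. The two summands give
  the two products, the second one by symmetry.\<close>

lemma mfps_pderiv_mult:
  "mfps_pderiv i (F * G) = mfps_pderiv i F * G + F * mfps_pderiv i G"
proof (rule mfps_eqI)
  fix m
  let ?s = "splittings (m + Poly_Mapping.single i 1)"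
  have "(\<Sum>(a, b)\<in>?s. of_nat (Poly_Mapping.lookup b i) * (mfps_nth F a * mfps_nth G b)) =
      (\<Sum>(a, b)\<in>?s. of_nat (Poly_Mapping.lookup a i) * (mfps_nth G a * mfps_nth F b))"
    by (rule sum.reindex_bij_witness[of _ prod.swap prod.swap])
      (auto simp: splittings_def algebra_simps)
  also have "\<dots> = mfps_nth (F * mfps_pderiv i G) m"
    by (subst sum_splittings_lookup_fst) (rule arg_cong[OF mult.commute, of "\<lambda>F. mfps_nth F m"])
  finally have *: "(\<Sum>(a, b)\<in>?s. of_nat (Poly_Mapping.lookup b i) * (mfps_nth F a * mfps_nth G b)) =
      mfps_nth (F * mfps_pderiv i G) m" .
  have "mfps_nth (mfps_pderiv i (F * G)) m =
      (\<Sum>(a, b)\<in>?s. of_nat (Suc (Poly_Mapping.lookup m i)) * (mfps_nth F a * mfps_nth G b))"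
    by (simp add: mfps_nth_pderiv mfps_nth_mult sum_distrib_left case_prod_unfold)
  also have "\<dots> = (\<Sum>(a, b)\<in>?s.
      of_nat (Poly_Mapping.lookup a i) * (mfps_nth F a * mfps_nth G b) +
      of_nat (Poly_Mapping.lookup b i) * (mfps_nth F a * mfps_nth G b))"
  proof (intro sum.cong refl, clarify)
    fix a b assume "(a, b) \<in> ?s"
    then have "Poly_Mapping.lookup (a + b) i = Suc (Poly_Mapping.lookup m i)"
      by (simp add: splittings_def lookup_add)
    then show "of_nat (Suc (Poly_Mapping.lookup m i)) * (mfps_nth F a * mfps_nth G b) =
        of_nat (Poly_Mapping.lookup a i) * (mfps_nth F a * mfps_nth G b) +
        of_nat (Poly_Mapping.lookup b i) * (mfps_nth F a * mfps_nth G b)"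
      by (metis distrib_right lookup_add of_nat_add)
  qed
  also have "\<dots> = mfps_nth (mfps_pderiv i F * G + F * mfps_pderiv i G) m"
    using * sum_splittings_lookup_fst[of i F G m]
    by (simp add: case_prod_unfold sum.distrib)
  finally show "mfps_nth (mfps_pderiv i (F * G)) m =
      mfps_nth (mfps_pderiv i F * G + F * mfps_pderiv i G) m" .
qed

lemma mfps_pderiv_prod:
  assumes "finite I"
  shows "mfps_pderiv k (\<Prod>v\<in>I. F v) = (\<Sum>v\<in>I. mfps_pderiv k (F v) * (\<Prod>w\<in>I - {v}. F w))"
  using assms
proof (induction I)
  case (insert x I)
  have "(\<Prod>w\<in>insert x I - {v}. F w) = F x * (\<Prod>w\<in>I - {v}. F w)" if "v \<in> I" for v
  proof -
    have "insert x I - {v} = insert x (I - {v})" using insert that by auto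
    then show ?thesis using insert by simp
  qed
  then show ?case
    using insert by (simp add: mfps_pderiv_mult sum_distrib_left algebra_simps)
qed simp

lemma mfps_pderiv_fps_at:
  "mfps_pderiv k (fps_at i f) = (if i = k then fps_at i (fps_deriv f) else 0)"
proof (cases "i = k")
  case True
  have "m + Poly_Mapping.single k 1 = Poly_Mapping.single k (Suc (Poly_Mapping.lookup m k)) \<longleftrightarrow>
      m = Poly_Mapping.single k (Poly_Mapping.lookup m k)" for m :: "nat \<Rightarrow>\<^sub>0 nat"
    by (metis add_right_cancel single_add Suc_eq_plus1)
  with True show ?thesis
    by (intro mfps_eqI) (simp add: mfps_nth_pderiv fps_at_def lookup_add)
next
  case False
  have "m + Poly_Mapping.single k 1 \<noteq> Poly_Mapping.single i l" for m :: "nat \<Rightarrow>\<^sub>0 nat" and l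
  proof
    assume "m + Poly_Mapping.single k 1 = Poly_Mapping.single i l"
    then have "Poly_Mapping.lookup (m + Poly_Mapping.single k 1) k = 0"
      using False by (simp add: lookup_single)
    then show False unfolding lookup_add by (simp add: lookup_single)
  qed
  with False show ?thesis
    by (intro mfps_eqI) (simp add: mfps_nth_pderiv fps_at_def)
qed

text \<open>Products of this shape are closed under derivatives up to sums, only the counter
  \<open>c\<close> changing; this is what makes both inductions, over internal vertices and over
  leaves, possible. In the uses below \<open>g v\<close> is the height of \<open>v\<close> plus one
  and \<open>c v\<close> the number of children attached so far.\<close>

lemma mfps_pderiv_prod_fps_at:
  assumes "finite I"
  shows "mfps_pderiv k (\<Prod>v\<in>I. fps_at (g v) ((fps_deriv ^^ c v) f)) =
    (\<Sum>v | v \<in> I \<and> g v = k. \<Prod>w\<in>I. fps_at (g w) ((fps_deriv ^^ (c(v := Suc (c v))) w) f))"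
proof -
  have "mfps_pderiv k (\<Prod>v\<in>I. fps_at (g v) ((fps_deriv ^^ c v) f)) =
      (\<Sum>v\<in>I. if g v = k then \<Prod>w\<in>I. fps_at (g w) ((fps_deriv ^^ (c(v := Suc (c v))) w) f) else 0)"
    unfolding mfps_pderiv_prod[OF assms]
  proof (rule sum.cong[OF refl])
    fix v assume v: "v \<in> I"
    show "mfps_pderiv k (fps_at (g v) ((fps_deriv ^^ c v) f)) *
        (\<Prod>w\<in>I - {v}. fps_at (g w) ((fps_deriv ^^ c w) f)) =
        (if g v = k then \<Prod>w\<in>I. fps_at (g w) ((fps_deriv ^^ (c(v := Suc (c v))) w) f) else 0)"
      by (subst prod.remove[OF assms v]) (auto simp: mfps_pderiv_fps_at intro!: prod.cong)
  qed
  then show ?thesis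
    using assms by (simp only: sum.inter_filter)
qed

lemma splittings_0: "splittings 0 = {(0, 0)}"
proof -
  have "a = 0" if "a + b = 0" for a b :: "nat \<Rightarrow>\<^sub>0 nat"
  proof (rule poly_mapping_eqI)
    fix i
    have "Poly_Mapping.lookup a i + Poly_Mapping.lookup b i = 0"
      unfolding lookup_add[symmetric] that by simp
    then show "Poly_Mapping.lookup a i = Poly_Mapping.lookup 0 i" by simp
  qed
  then show ?thesis
    unfolding splittings_def by (force simp: add.commute)
qed

text \<open>The zero exponent splits only trivially, so setting all variables to 0 is
  multiplicative. This ends the extraction of coefficients once all leaves are placed.\<close>

lemma mfps_nth_0_prod: "mfps_nth (\<Prod>i\<in>I. F i) 0 = (\<Prod>i\<in>I. mfps_nth (F i) 0)"
  by (induction I rule: infinite_finite_induct)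
    (simp_all add: mfps_nth_mult mfps_nth_one splittings_0)

section \<open>Exponential coefficients\<close>

text \<open>The factor m_i + 1 of the derivative is absorbed by (m_i + 1)! = (m_i + 1) m_i!, so with
  this normalisation no constant remains.\<close>

lemma egf_coeff_add_single:
  "egf_coeff F (m + Poly_Mapping.single i 1) = egf_coeff (mfps_pderiv i F) m"
proof -
  let ?e = "Poly_Mapping.single i (1::nat)"
  let ?A = "insert i (Poly_Mapping.keys m)"
  \<comment> \<open>Adding x_i may enlarge the set of keys; since 0! = 1, both products can be taken
    over the common set \<open>?A\<close>.\<close>
  have keys: "(\<Prod>j\<in>Poly_Mapping.keys m'. fact (Poly_Mapping.lookup m' j)) =
      (\<Prod>j\<in>?A. fact (Poly_Mapping.lookup m' j) :: nat)" if "Poly_Mapping.keys m' \<subseteq> ?A" for m'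
    by (rule prod.mono_neutral_left) (use that in \<open>auto simp: in_keys_iff\<close>)
  have "(\<Prod>j\<in>Poly_Mapping.keys (m + ?e). fact (Poly_Mapping.lookup (m + ?e) j)) =
      (\<Prod>j\<in>?A. fact (Poly_Mapping.lookup (m + ?e) j) :: nat)"
    by (rule keys) (use keys_add[of m ?e] in auto)
  also have "\<dots> = Suc (Poly_Mapping.lookup m i) * (\<Prod>j\<in>?A. fact (Poly_Mapping.lookup m j))"
  proof -
    have "(\<Prod>j\<in>?A - {i}. fact (Poly_Mapping.lookup (m + ?e) j)) =
        (\<Prod>j\<in>?A - {i}. fact (Poly_Mapping.lookup m j) :: nat)"
      by (rule prod.cong) (auto simp: lookup_add lookup_single)
    then show ?thesis
      by (simp only: prod.remove[of ?A i] finite_insert finite_keys insertI1)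
        (simp add: lookup_add algebra_simps)
  qed
  also have "(\<Prod>j\<in>?A. fact (Poly_Mapping.lookup m j)) =
      (\<Prod>j\<in>Poly_Mapping.keys m. fact (Poly_Mapping.lookup m j) :: nat)"
    by (rule keys[symmetric]) auto
  finally have *: "(\<Prod>j\<in>Poly_Mapping.keys (m + ?e). fact (Poly_Mapping.lookup (m + ?e) j)) =
      Suc (Poly_Mapping.lookup m i) *
      (\<Prod>j\<in>Poly_Mapping.keys m. fact (Poly_Mapping.lookup m j))" .
  show ?thesis
    unfolding egf_coeff_def mfps_nth_pderiv * of_nat_mult by (simp add: algebra_simps)
qed

lemma egf_coeff_sum: "egf_coeff (\<Sum>i\<in>I. F i) m = (\<Sum>i\<in>I. egf_coeff (F i) m)"
  by (simp add: egf_coeff_def mfps_nth_sum sum_distrib_left)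

lemma egf_coeff_const_mult: "egf_coeff (mfps_const c * F) m = c * egf_coeff F m"
  by (simp add: egf_coeff_def mult.left_commute)

lemma egf_coeff_0: "egf_coeff F 0 = mfps_nth F 0"
  by (simp add: egf_coeff_def)

lemma fps_egf_coeff_deriv: "fps_egf_coeff (fps_deriv f) k = fps_egf_coeff f (Suc k)"
  unfolding fps_egf_coeff_def fps_deriv_nth Suc_eq_plus1[symmetric] fact_Suc of_nat_mult of_nat_id
  by (simp only: mult_ac)

lemma fps_nth_0_deriv: "fps_nth ((fps_deriv ^^ c) f) 0 = fps_egf_coeff f c"
proof -
  \<comment> \<open>Each derivative shifts the index, so the induction needs every \<open>k\<close>,
    although only the constant term is wanted.\<close>
  have "fps_egf_coeff ((fps_deriv ^^ c) f) k = fps_egf_coeff f (k + c)" for k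
    by (induction c arbitrary: k) (simp_all add: fps_egf_coeff_deriv)
  from this[of 0] show ?thesis by (simp add: fps_egf_coeff_def)
qed

lemma lookup_sum_single:
  assumes "finite A"
  shows "Poly_Mapping.lookup (\<Sum>i\<in>A. Poly_Mapping.single i (f i)) r = (if r \<in> A then f r else 0)"
  using assms by (simp add: lookup_sum lookup_single when_def)

lemma lookup_color_monom:
  "Poly_Mapping.lookup (color_monom n V \<kappa>) r = (if r \<in> {1..n} then card {v \<in> V. \<kappa> v = r} else 0)"
  unfolding color_monom_def by (rule lookup_sum_single) simp

text \<open>\<open>color_monom\<close> records only the colours from 1 to \<open>n\<close>; a leaf
  of any other colour would leave it unchanged.\<close>

lemma color_monom_insert:
  assumes "finite V" "l \<notin> V" "\<kappa> l \<in> {1..n}"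
  shows "color_monom n (insert l V) \<kappa> = color_monom n V \<kappa> + Poly_Mapping.single (\<kappa> l) 1"
proof (rule poly_mapping_eqI)
  fix r
  show "Poly_Mapping.lookup (color_monom n (insert l V) \<kappa>) r =
      Poly_Mapping.lookup (color_monom n V \<kappa> + Poly_Mapping.single (\<kappa> l) 1) r"
  proof (cases "\<kappa> l = r")
    case True
    then have "{v \<in> insert l V. \<kappa> v = r} = insert l {v \<in> V. \<kappa> v = r}" by auto
    with True assms show ?thesis by (simp add: lookup_add lookup_color_monom)
  next
    case False
    then have "{v \<in> insert l V. \<kappa> v = r} = {v \<in> V. \<kappa> v = r}" by auto
    with False show ?thesis by (simp add: lookup_add lookup_color_monom lookup_single)
  qed
qed

text \<open>Induction on the set of leaves: the derivative for the colour of \<open>l\<close>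
  chooses the parent \<open>\<pi> l\<close> on the level just above. The counter \<open>c\<close> is
  arbitrary because each choice raises it at one vertex.\<close>

lemma egf_coeff_prod_fps_at:
  assumes "finite I" "finite V" "\<kappa> ` V \<subseteq> {1..n}"
  shows "egf_coeff (\<Prod>v\<in>I. fps_at (g v) ((fps_deriv ^^ c v) f)) (color_monom n V \<kappa>) =
    (\<Sum>\<pi>\<in>(\<Pi>\<^sub>E l\<in>V. {v \<in> I. g v = \<kappa> l}). \<Prod>v\<in>I. fps_egf_coeff f (c v + card {l \<in> V. \<pi> l = v}))"
  using assms(2,3)
proof (induction V arbitrary: c)
  case empty
  have "color_monom n {} \<kappa> = 0"
    by (rule poly_mapping_eqI) (simp add: lookup_color_monom)
  then show ?case
    by (simp add: egf_coeff_0 mfps_nth_0_prod fps_at_def fps_nth_0_deriv)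
next
  case (insert l V)
  \<comment> \<open>Raising the counter at \<open>u\<close> by the derivative has the same effect as
    counting \<open>l\<close> in the fibre of \<open>\<pi>\<close> over \<open>u\<close>.\<close>
  have card: "(c(u := Suc (c u))) v + card {x \<in> V. \<pi> x = v} =
      c v + card {x \<in> insert l V. (\<pi>(l := u)) x = v}" for \<pi> u v
  proof -
    have "{x \<in> insert l V. (\<pi>(l := u)) x = v} =
        (if u = v then insert l {x \<in> V. \<pi> x = v} else {x \<in> V. \<pi> x = v})"
      using insert.hyps by auto
    then show ?thesis using insert.hyps by auto
  qed
  have "egf_coeff (\<Prod>v\<in>I. fps_at (g v) ((fps_deriv ^^ c v) f)) (color_monom n (insert l V) \<kappa>) =
      egf_coeff (mfps_pderiv (\<kappa> l) (\<Prod>v\<in>I. fps_at (g v) ((fps_deriv ^^ c v) f))) (color_monom n V \<kappa>)"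
    using insert.hyps insert.prems
    by (simp add: color_monom_insert egf_coeff_add_single[simplified])
  also have "\<dots> = (\<Sum>u | u \<in> I \<and> g u = \<kappa> l. \<Sum>\<pi>\<in>(\<Pi>\<^sub>E l\<in>V. {v \<in> I. g v = \<kappa> l}).
      \<Prod>v\<in>I. fps_egf_coeff f ((c(u := Suc (c u))) v + card {x \<in> V. \<pi> x = v}))"
    using insert.prems
    by (simp only: mfps_pderiv_prod_fps_at[OF assms(1)] egf_coeff_sum)
      (intro sum.cong refl insert.IH, simp)
  also have "\<dots> = (\<Sum>\<pi>\<in>(\<Pi>\<^sub>E l\<in>insert l V. {v \<in> I. g v = \<kappa> l}).
      \<Prod>v\<in>I. fps_egf_coeff f (c v + card {x \<in> insert l V. \<pi> x = v}))"
    by (subst sum_PiE_insert[OF insert.hyps(2)], subst sum.swap) (simp only: card)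
  finally show ?case .
qed

section \<open>Expansion over recursive trees\<close>

text \<open>
  The parent functions of the increasing trees on \<open>[n]\<close> without leaves; the root \<open>1\<close> has no parent.
\<close>

definition rec_trees :: "nat \<Rightarrow> (nat \<Rightarrow> nat) set" where
  "rec_trees n = (\<Pi>\<^sub>E v\<in>{2..n}. {1..<v})"

text \<open>The test \<open>p v < v\<close> only serves termination: it holds for all parent functions.\<close>

fun depth :: "(nat \<Rightarrow> nat) \<Rightarrow> nat \<Rightarrow> nat" where
  "depth p v = (if 2 \<le> v \<and> p v < v then Suc (depth p (p v)) else 0)"

declare depth.simps [simp del]

definition internal_children :: "nat \<Rightarrow> (nat \<Rightarrow> nat) \<Rightarrow> nat \<Rightarrow> nat" where
  "internal_children n p v = card {w \<in> {2..n}. p w = v}"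

lemma finite_rec_trees: "finite (rec_trees n)"
  unfolding rec_trees_def by (rule finite_PiE) auto

lemma rec_trees_bounds:
  assumes "p \<in> rec_trees n" "v \<in> {2..n}"
  shows "1 \<le> p v" "p v < v"
  using assms unfolding rec_trees_def by (auto dest: PiE_mem)

lemma depth_1: "depth p (Suc 0) = 0"
  by (subst depth.simps) simp

lemma depth_parent: "p \<in> rec_trees n \<Longrightarrow> v \<in> {2..n} \<Longrightarrow> depth p v = Suc (depth p (p v))"
  using rec_trees_bounds by (subst depth.simps) auto

text \<open>Labels drop by at least one at each step towards the root. This bounds all heights by
  \<open>n - 1\<close>.\<close>

lemma depth_le: "depth p v \<le> v - 1"
proof (induction v rule: less_induct)
  case (less v)
  show ?case
  proof (cases "2 \<le> v \<and> p v < v")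
    case True
    then have "depth p v = Suc (depth p (p v))" by (subst depth.simps) simp
    with True less[of "p v"] show ?thesis by linarith
  next
    case False
    then show ?thesis unfolding depth.simps[of p v] if_not_P[OF False] by simp
  qed
qed

text \<open>The recursion visits only labels up to \<open>v\<close>, so attaching a vertex with a
  larger label leaves existing depths alone.\<close>

lemma depth_cong: "(\<And>w. w \<le> v \<Longrightarrow> p w = p' w) \<Longrightarrow> depth p v = depth p' v"
proof (induction v rule: less_induct)
  case (less v)
  have "depth p (p v) = depth p' (p v)" if "p v < v"
    using that less.prems by (intro less.IH) auto
  then show ?case
    using less.prems[of v] by (subst (1 2) depth.simps) auto
qed

text \<open>The vertex \<open>Suc n\<close> chooses any earlier vertex as its parent. Passing from 0
  to 1 vertices offers no such choice, as 1 is the root; hence the bound on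
  \<open>n\<close>.\<close>

lemma sum_rec_trees_Suc:
  assumes "1 \<le> n"
  shows "(\<Sum>p\<in>rec_trees (Suc n). g p) = (\<Sum>p\<in>rec_trees n. \<Sum>u=1..n. g (p(Suc n := u)))"
proof -
  have "{2..Suc n} = insert (Suc n) {2..n}" using assms by auto
  moreover have "{1..<Suc n} = {1..n}" by auto
  ultimately show ?thesis
    unfolding rec_trees_def using sum_PiE_insert[of "Suc n" "{2..n}" g "\<lambda>v. {1..<v}"]
    by (metis atLeastAtMost_iff not_less_eq_eq order_refl)
qed

lemma internal_children_extend:
  assumes "1 \<le> n" "u \<in> {1..n}" "v \<in> {1..n}"
  shows "internal_children (Suc n) (p(Suc n := u)) v =
    ((internal_children n p)(u := Suc (internal_children n p u))) v"
proof -
  have set_eq: "{2..Suc n} = insert (Suc n) {2..n}" using assms(1) by auto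
  show ?thesis
  proof (cases "u = v")
    case True
    then have "{w \<in> {2..Suc n}. (p(Suc n := u)) w = v} = insert (Suc n) {w \<in> {2..n}. p w = v}"
      unfolding set_eq by auto
    with True show ?thesis by (simp add: internal_children_def)
  next
    case False
    then have "{w \<in> {2..Suc n}. (p(Suc n := u)) w = v} = {w \<in> {2..n}. p w = v}"
      unfolding set_eq by auto
    with False show ?thesis by (simp add: internal_children_def)
  qed
qed

lemma internal_children_last:
  assumes "p \<in> rec_trees (Suc n)"
  shows "internal_children (Suc n) p (Suc n) = 0"
proof -
  have "{w \<in> {2..Suc n}. p w = Suc n} = {}"
    using rec_trees_bounds[OF assms] by fastforce
  then show ?thesis by (simp add: internal_children_def)
qed

text \<open>The coefficient of x^k / k! in the c-th derivative of phi is phi[c + k]. The factor of a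
  vertex with c internal children therefore accounts for any number k of leaves that may still be
  attached to it, all lying one level deeper.\<close>

definition tree_term :: "'a::comm_ring_1 fps \<Rightarrow> nat \<Rightarrow> (nat \<Rightarrow> nat) \<Rightarrow> 'a qpoly mfps" where
  "tree_term \<phi> n p =
    mfps_const (\<Prod>v=1..n. q_var (depth p v)) *
    (\<Prod>v=1..n. fps_at (Suc (depth p v))
      ((fps_deriv ^^ internal_children n p v) (Abs_fps (\<lambda>j. q_const (fps_nth \<phi> j)))))"

lemma D_op_sum: "D_op \<phi> m (\<Sum>i\<in>I. F i) = (\<Sum>i\<in>I. D_op \<phi> m (F i))"
  unfolding D_op_def mfps_pderiv_sum sum_distrib_left by (rule sum.swap)

text \<open>A sum over the index k and then over the vertices whose factor involves x_k is a single
  sum over all possible parents \<open>u\<close> of the new vertex.\<close>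

lemma D_op_tree_term:
  assumes n: "1 \<le> n" and p: "p \<in> rec_trees n"
  shows "D_op \<phi> (Suc n) (tree_term \<phi> n p) = (\<Sum>u=1..n. tree_term \<phi> (Suc n) (p(Suc n := u)))"
proof -
  define f where "f = Abs_fps (\<lambda>j. q_const (fps_nth \<phi> j))"
  define g where "g = (\<lambda>v. Suc (depth p v))"
  define c where "c = internal_children n p"
  define C where "C = (\<Prod>v=1..n. q_var (depth p v) :: 'a qpoly)"
  define G where "G = (\<lambda>u. \<Prod>w=1..n. fps_at (g w) ((fps_deriv ^^ (c(u := Suc (c u))) w) f))"
  have step: "tree_term \<phi> (Suc n) (p(Suc n := u)) =
      fps_at (Suc (g u)) f * mfps_const (q_var (g u)) * (mfps_const C * G u)"
    if u: "u \<in> {1..n}" for u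
  proof -
    let ?p = "p(Suc n := u)"
    have p': "?p \<in> rec_trees (Suc n)"
    proof -
      have "{2..Suc n} = insert (Suc n) {2..n}" using n by auto
      then show ?thesis
        using p u unfolding rec_trees_def by (auto simp: PiE_fun_upd)
    qed
    \<comment> \<open>The old vertices keep their heights, so among their factors only that of
      \<open>u\<close> changes.\<close>
    have d: "depth ?p v = depth p v" if "v \<in> {1..n}" for v
      by (rule depth_cong) (use that in auto)
    have dn: "depth ?p (Suc n) = g u"
      using depth_parent[OF p', of "Suc n"] n d[OF u] by (simp add: g_def)
    have "(\<Prod>v=1..Suc n. q_var (depth ?p v)) = q_var (g u) * C"
      using d dn by (simp add: prod.cl_ivl_Suc C_def mult.commute)
    moreover have "(\<Prod>v=1..Suc n. fps_at (Suc (depth ?p v))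
        ((fps_deriv ^^ internal_children (Suc n) ?p v) f)) = fps_at (Suc (g u)) f * G u"
      using d dn internal_children_extend[OF n u, of _ p] internal_children_last[OF p']
      by (simp add: prod.cl_ivl_Suc G_def c_def g_def mult.commute)
    ultimately show ?thesis
      unfolding tree_term_def f_def[symmetric] by (simp add: mfps_const_mult mult_ac)
  qed
  have "mfps_pderiv k (tree_term \<phi> n p) = mfps_const C * (\<Sum>u | u \<in> {1..n} \<and> g u = k. G u)" for k
    unfolding tree_term_def mfps_pderiv_const_mult f_def[symmetric]
      mfps_pderiv_prod_fps_at[OF finite_atLeastAtMost]
    by (simp add: C_def G_def g_def c_def)
  then have "D_op \<phi> (Suc n) (tree_term \<phi> n p) =
      (\<Sum>k<Suc n. \<Sum>u | u \<in> {1..n} \<and> g u = k.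
        fps_at (Suc (g u)) f * mfps_const (q_var (g u)) * (mfps_const C * G u))"
    by (simp add: D_op_def f_def sum_distrib_left del: sum.lessThan_Suc)
  \<comment> \<open>Depths are at most \<open>n - 1\<close>, so every \<open>g u\<close> is at most
    \<open>n\<close> and the range of the operator reaches each vertex.\<close>
  also have "\<dots> = (\<Sum>u\<in>{1..n}. fps_at (Suc (g u)) f * mfps_const (q_var (g u)) * (mfps_const C * G u))"
  proof (rule sum.group)
    show "g ` {1..n} \<subseteq> {..<Suc n}"
    proof (rule image_subsetI)
      fix v assume "v \<in> {1..n}"
      then show "g v \<in> {..<Suc n}" using depth_le[of p v] by (auto simp: g_def)
    qed
  qed auto
  also have "\<dots> = (\<Sum>u=1..n. tree_term \<phi> (Suc n) (p(Suc n := u)))"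
    by (rule sum.cong[OF refl]) (rule step[symmetric])
  finally show ?thesis .
qed

text \<open>D_1 consists of the derivative in x_0 alone, which consumes the seed.\<close>

lemma mfps_pderiv_var: "mfps_pderiv i (mfps_var i) = 1"
proof (rule mfps_eqI)
  fix m :: "nat \<Rightarrow>\<^sub>0 nat"
  have a: "m + Poly_Mapping.single i 1 = Poly_Mapping.single i 1 \<longleftrightarrow> m = 0"
    using add_right_cancel[of m "Poly_Mapping.single i 1" 0] unfolding add_0 .
  show "mfps_nth (mfps_pderiv i (mfps_var i)) m = (mfps_nth 1 m)"
    unfolding mfps_nth_pderiv mfps_var_def mfps_nth_one mfps_nth_Abs a by simp
qed

text \<open>The induction starts at 1 because the seed x_0 itself is not a product of factors
  phi^{(c)}(x_{h+1}); the first operator creates the one-vertex tree.\<close>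

lemma T_series_expand: "1 \<le> n \<Longrightarrow> T_series \<phi> n = (\<Sum>p\<in>rec_trees n. tree_term \<phi> n p)"
proof (induction n rule: nat_induct_at_least)
  case base
  have "rec_trees 1 = {\<lambda>_. undefined}" by (simp add: rec_trees_def)
  moreover have "T_series \<phi> 1 = tree_term \<phi> 1 p" for p
    by (simp add: T_series_def D_op_def tree_term_def depth_1 internal_children_def mfps_pderiv_var
        mult.commute)
  ultimately show ?case by simp
next
  case (Suc n)
  have "T_series \<phi> (Suc n) = D_op \<phi> (Suc n) (T_series \<phi> n)"
    by (simp add: T_series_def)
  also have "\<dots> = (\<Sum>p\<in>rec_trees n. D_op \<phi> (Suc n) (tree_term \<phi> n p))"
    unfolding Suc.IH D_op_sum ..
  also have "\<dots> = (\<Sum>p\<in>rec_trees n. \<Sum>u=1..n. tree_term \<phi> (Suc n) (p(Suc n := u)))"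
    by (rule sum.cong[OF refl]) (rule D_op_tree_term[OF Suc.hyps])
  also have "\<dots> = (\<Sum>p\<in>rec_trees (Suc n). tree_term \<phi> (Suc n) p)"
    by (rule sum_rec_trees_Suc[OF Suc.hyps, symmetric])
  finally show ?case .
qed

section \<open>Supports\<close>

text \<open>One predicate bounds the x-variables and the q-variables together. It asks for
  inclusions only, so cancellation among coefficients does no harm.\<close>

definition supported_in :: "nat set \<Rightarrow> nat set \<Rightarrow> 'a::comm_ring_1 qpoly mfps \<Rightarrow> bool" where
  "supported_in A B F \<longleftrightarrow> (\<forall>m. \<forall>p\<in>Poly_Mapping.keys (mfps_nth F m).
     Poly_Mapping.keys m \<subseteq> A \<and> Poly_Mapping.keys p \<subseteq> B)"

lemma keys_qpoly_mult_subset: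
  assumes "p \<in> Poly_Mapping.keys (x * y :: 'a::comm_ring_1 qpoly)"
  obtains a b where "a \<in> Poly_Mapping.keys x" "b \<in> Poly_Mapping.keys y" "p = a + b"
  using assms keys_mult[of x y] by blast

text \<open>Natural exponents cannot cancel, so the keys of a sum of exponents are exactly the
  union.\<close>

lemma keys_add_nat: "Poly_Mapping.keys (a + b) = Poly_Mapping.keys a \<union> Poly_Mapping.keys b"
  for a b :: "nat \<Rightarrow>\<^sub>0 nat"
  by (auto simp: in_keys_iff lookup_add)

lemma keys_sum_subset:
  "Poly_Mapping.keys (\<Sum>i\<in>I. f i) \<subseteq> (\<Union>i\<in>I. Poly_Mapping.keys (f i))"
proof (induction I rule: infinite_finite_induct)
  case (insert x I)
  then show ?case using keys_add[of "f x" "sum f I"] by auto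
qed auto

lemma keys_sumE:
  assumes "p \<in> Poly_Mapping.keys (\<Sum>i\<in>I. f i)"
  obtains i where "i \<in> I" "p \<in> Poly_Mapping.keys (f i)"
  using assms keys_sum_subset[of f I] by blast

lemma supported_in_sum:
  assumes "\<And>i. i \<in> I \<Longrightarrow> supported_in A B (F i)"
  shows "supported_in A B (\<Sum>i\<in>I. F i)"
  unfolding supported_in_def mfps_nth_sum
proof (intro allI ballI)
  fix m p
  assume "p \<in> Poly_Mapping.keys (\<Sum>i\<in>I. mfps_nth (F i) m)"
  then obtain i where "i \<in> I" "p \<in> Poly_Mapping.keys (mfps_nth (F i) m)"
    by (rule keys_sumE)
  with assms[of i] show "Poly_Mapping.keys m \<subseteq> A \<and> Poly_Mapping.keys p \<subseteq> B"
    unfolding supported_in_def by blast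
qed

lemma supported_in_mult:
  assumes "supported_in A B F" "supported_in A B G"
  shows "supported_in A B (F * G)"
  unfolding supported_in_def mfps_nth_mult
proof (intro allI ballI)
  fix m p
  assume "p \<in> Poly_Mapping.keys (\<Sum>(a, b)\<in>splittings m. mfps_nth F a * mfps_nth G b)"
  then obtain x where x: "x \<in> splittings m"
      "p \<in> Poly_Mapping.keys (case x of (a, b) \<Rightarrow> mfps_nth F a * mfps_nth G b)"
    by (rule keys_sumE)
  then obtain a b where ab: "a + b = m" "p \<in> Poly_Mapping.keys (mfps_nth F a * mfps_nth G b)"
    by (cases x) (simp add: splittings_def)
  then obtain r s where "r \<in> Poly_Mapping.keys (mfps_nth F a)"
      "s \<in> Poly_Mapping.keys (mfps_nth G b)" "p = r + s"
    by (elim keys_qpoly_mult_subset)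
  with ab(1) assms show "Poly_Mapping.keys m \<subseteq> A \<and> Poly_Mapping.keys p \<subseteq> B"
    unfolding supported_in_def by (metis Un_least keys_add_nat)
qed

lemma supported_in_one: "supported_in A B 1"
  by (auto simp: supported_in_def mfps_nth_one)

lemma supported_in_prod:
  "(\<And>i. i \<in> I \<Longrightarrow> supported_in A B (F i)) \<Longrightarrow> supported_in A B (\<Prod>i\<in>I. F i)"
  by (induction I rule: infinite_finite_induct) (auto intro: supported_in_mult supported_in_one)

lemma mfps_const_1: "mfps_const 1 = 1"
  by (simp add: mfps_const_def one_mfps_def)

lemma mfps_const_prod: "mfps_const (\<Prod>i\<in>I. c i) = (\<Prod>i\<in>I. mfps_const (c i))"
  by (induction I rule: infinite_finite_induct) (simp_all add: mfps_const_mult mfps_const_1)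

lemma supported_in_q_var: "k \<in> B \<Longrightarrow> supported_in A B (mfps_const (q_var k))"
  by (auto simp: supported_in_def mfps_const_def q_var_def split: if_splits)

text \<open>The condition on \<open>f\<close> says that its coefficients are constants, free of the
  q-variables.\<close>

lemma supported_in_fps_at:
  assumes "i \<in> A" "\<And>j. Poly_Mapping.keys (fps_nth f j) \<subseteq> {0}"
  shows "supported_in A B (fps_at i f)"
proof -
  have "Poly_Mapping.keys m \<subseteq> A \<and> Poly_Mapping.keys p \<subseteq> B"
    if "p \<in> Poly_Mapping.keys (mfps_nth (fps_at i f) m)" for m p
  proof -
    have m: "m = Poly_Mapping.single i (Poly_Mapping.lookup m i)" and "p = 0"
      using that assms(2) by (auto simp: fps_at_def split: if_splits)
    have "Poly_Mapping.keys m \<subseteq> {i}" by (subst m) simp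
    with \<open>p = 0\<close> assms(1) show ?thesis by auto
  qed
  then show ?thesis by (auto simp: supported_in_def)
qed

lemma q_const_mult: "q_const (a * b) = q_const a * q_const b"
  by (simp add: q_const_def mult_single)

lemma q_const_of_nat: "q_const (of_nat k) = of_nat k"
  by (induction k) (simp_all add: q_const_def single_add)

text \<open>Integer factors are constants of the polynomial ring, so differentiating does not leave
  the series with constant coefficients.\<close>

lemma fps_deriv_q_const:
  "fps_deriv (Abs_fps (\<lambda>j. q_const (fps_nth \<phi> j))) = Abs_fps (\<lambda>j. q_const (fps_nth (fps_deriv \<phi>) j))"
  by (rule fps_ext) (simp add: q_const_mult q_const_of_nat[symmetric] del: of_nat_Suc)

lemma fps_deriv_funpow_q_const:
  "(fps_deriv ^^ c) (Abs_fps (\<lambda>j. q_const (fps_nth \<phi> j))) =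
    Abs_fps (\<lambda>j. q_const (fps_nth ((fps_deriv ^^ c) \<phi>) j))"
  by (induction c) (simp_all add: fps_deriv_q_const)

lemma fps_egf_coeff_q_const:
  "fps_egf_coeff (Abs_fps (\<lambda>j. q_const (fps_nth \<phi> j))) k = q_const (fps_egf_coeff \<phi> k)"
  by (simp add: fps_egf_coeff_def q_const_mult q_const_of_nat)

text \<open>Read off the expansion over trees: a vertex of height h brings in q_h and x_{h+1}, with
  h between 0 and \<open>n - 1\<close>.\<close>

lemma supported_in_T_series:
  assumes "1 \<le> n"
  shows "supported_in {1..n} {0..n - 1} (T_series \<phi> n)"
proof -
  have d: "depth p v \<le> n - 1" if "v \<in> {1..n}" for p v
    using depth_le[of p v] that by auto
  show ?thesis
    unfolding T_series_expand[OF assms] tree_term_def mfps_const_prod fps_deriv_funpow_q_const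
  proof (intro supported_in_sum supported_in_mult supported_in_prod supported_in_q_var
      supported_in_fps_at)
    fix p v assume v: "v \<in> {1..n}"
    show "depth p v \<in> {0..n - 1}" using d[OF v] by simp
    show "Suc (depth p v) \<in> {1..n}" using d[OF v, of p] assms by simp
  qed (auto simp: q_const_def split: if_splits)
qed

lemma T_coeff_expand:
  assumes "1 \<le> n" "finite V" "\<kappa> ` V \<subseteq> {1..n}"
  shows "T_coeff \<phi> n V \<kappa> = (\<Sum>p\<in>rec_trees n.
    \<Sum>\<pi>\<in>(\<Pi>\<^sub>E l\<in>V. {v \<in> {1..n}. Suc (depth p v) = \<kappa> l}).
      \<Prod>v=1..n. q_const (fps_egf_coeff \<phi> (internal_children n p v + card {l \<in> V. \<pi> l = v})) *
        q_var (depth p v))"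
  unfolding T_coeff_def T_series_expand[OF assms(1)] egf_coeff_sum tree_term_def
    egf_coeff_const_mult egf_coeff_prod_fps_at[OF finite_atLeastAtMost assms(2,3)]
    sum_distrib_left fps_egf_coeff_q_const prod.distrib
  by (simp only: mult.commute)

section \<open>Increasing trees as parent functions\<close>

definition tree_edges ::
  "nat \<Rightarrow> 'v set \<Rightarrow> (nat \<Rightarrow> nat) \<Rightarrow> ('v \<Rightarrow> nat) \<Rightarrow> ((nat + 'v) \<times> (nat + 'v)) set" where
  "tree_edges n V p \<pi> =
    (\<lambda>v. (Inl (p v), Inl v)) ` {2..n} \<union> (\<lambda>l. (Inl (\<pi> l), Inr l)) ` V"

definition tree_of :: "nat \<Rightarrow> 'v set \<Rightarrow> (nat \<Rightarrow> nat) \<Rightarrow> ('v \<Rightarrow> nat) \<Rightarrow>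
    (nat + 'v) \<times> ((nat + 'v) \<times> (nat + 'v)) set" where
  "tree_of n V p \<pi> = (Inl 1, tree_edges n V p \<pi>)"

lemma tree_edges_Inl_iff:
  "(x, Inl v) \<in> tree_edges n V p \<pi> \<longleftrightarrow> v \<in> {2..n} \<and> x = Inl (p v)"
  by (auto simp: tree_edges_def)

lemma tree_edges_Inr_iff:
  "(x, Inr l) \<in> tree_edges n V p \<pi> \<longleftrightarrow> l \<in> V \<and> x = Inl (\<pi> l)"
  by (auto simp: tree_edges_def)

lemma relpow_Suc_iff: "(x, z) \<in> R ^^ Suc d \<longleftrightarrow> (\<exists>y. (x, y) \<in> R ^^ d \<and> (y, z) \<in> R)"
  by auto

text \<open>Parents are unique, so walking back from \<open>v\<close> forces the length of the path.
  As an equivalence in \<open>d\<close>, it leaves one candidate for the \<open>LEAST\<close> in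
  \<open>height\<close>.\<close>

lemma tree_path_internal_iff:
  assumes "p \<in> rec_trees n" "v \<in> {1..n}"
  shows "(Inl 1, Inl v) \<in> tree_edges n V p \<pi> ^^ d \<longleftrightarrow> d = depth p v"
  using assms(2)
proof (induction d arbitrary: v)
  case 0
  show ?case
  proof (cases "v = 1")
    case False
    then have "depth p v = Suc (depth p (p v))"
      using depth_parent[OF assms(1), of v] 0 by simp
    with False show ?thesis by simp
  qed (simp add: depth_1)
next
  case (Suc d)
  show ?case
  proof (cases "v = 1")
    case True
    then show ?thesis
      unfolding relpow_Suc_iff tree_edges_Inl_iff by (simp add: depth_1)
  next
    case False
    then have v: "v \<in> {2..n}" using Suc.prems by auto
    then have "p v \<in> {1..n}" using rec_trees_bounds[OF assms(1) v] by auto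
    from Suc.IH[OF this] show ?thesis
      unfolding relpow_Suc_iff tree_edges_Inl_iff depth_parent[OF assms(1) v] using v by simp
  qed
qed

lemma tree_path_leaf_iff:
  assumes "p \<in> rec_trees n" "l \<in> V" "\<pi> l \<in> {1..n}"
  shows "(Inl 1, Inr l) \<in> tree_edges n V p \<pi> ^^ d \<longleftrightarrow> d = Suc (depth p (\<pi> l))"
proof (cases d)
  case (Suc e)
  show ?thesis
    unfolding Suc relpow_Suc_iff tree_edges_Inr_iff
    using assms(2) tree_path_internal_iff[OF assms(1,3)] by simp
qed simp

lemma height_tree_of_internal:
  assumes "p \<in> rec_trees n" "v \<in> {1..n}"
  shows "height (tree_of n V p \<pi>) (Inl v) = depth p v"
  unfolding height_def tree_of_def fst_conv snd_conv tree_path_internal_iff[OF assms]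
  by (rule Least_equality) auto

lemma height_tree_of_leaf:
  assumes "p \<in> rec_trees n" "l \<in> V" "\<pi> l \<in> {1..n}"
  shows "height (tree_of n V p \<pi>) (Inr l) = Suc (depth p (\<pi> l))"
  unfolding height_def tree_of_def fst_conv snd_conv tree_path_leaf_iff[of p n l V \<pi>, OF assms]
  by (rule Least_equality) auto

lemma card_children_tree_of:
  assumes "finite V"
  shows "card (children (tree_of n V p \<pi>) (Inl v)) =
    internal_children n p v + card {l \<in> V. \<pi> l = v}"
proof -
  have "children (tree_of n V p \<pi>) (Inl v) = {w \<in> {2..n}. p w = v} <+> {l \<in> V. \<pi> l = v}"
    by (auto simp: children_def tree_of_def tree_edges_def)
  then show ?thesis
    using assms by (simp add: card_Plus internal_children_def)
qed

section \<open>The bijection between pairs of parent functions and increasing trees\<close>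

lemma tree_of_in_increasing_trees:
  assumes "1 \<le> n" "p \<in> rec_trees n" "\<pi> \<in> V \<rightarrow>\<^sub>E {1..n}"
  shows "tree_of n V p \<pi> \<in> increasing_trees n V"
proof -
  let ?E = "tree_edges n V p \<pi>" and ?W = "{1..n} <+> V"
  have pi: "\<pi> l \<in> {1..n}" if "l \<in> V" for l
    using assms(3) that by (rule PiE_mem)
  have p: "p v \<in> {1..n}" if "v \<in> {2..n}" for v
    using rec_trees_bounds[OF assms(2) that] that by auto
  have "?E \<subseteq> ?W \<times> ?W"
    using pi p unfolding tree_edges_def by fastforce
  moreover have "(u, Inl 1) \<notin> ?E" for u
    by (simp add: tree_edges_Inl_iff)
  moreover have "\<exists>!u. (u, w) \<in> ?E" if "w \<in> ?W - {Inl 1}" for w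
  proof (cases w)
    case (Inl v)
    with that have "v \<in> {2..n}" by auto
    with Inl show ?thesis by (auto simp: tree_edges_Inl_iff)
  next
    case (Inr l)
    with that show ?thesis by (auto simp: tree_edges_Inr_iff)
  qed
  moreover have "(Inl 1, w) \<in> ?E\<^sup>*" if "w \<in> ?W" for w
  proof (cases w)
    case (Inl v)
    with that have "v \<in> {1..n}" by auto
    with Inl tree_path_internal_iff[OF assms(2)] show ?thesis
      by (metis relpow_imp_rtrancl)
  next
    case (Inr l)
    with that have "l \<in> V" by auto
    from tree_path_leaf_iff[of p n l V \<pi> "Suc (depth p (\<pi> l))", OF assms(2) this pi[OF this]] Inr
    show ?thesis by (metis relpow_imp_rtrancl)
  qed
  ultimately have "rooted_tree ?W (Inl 1) ?E"
    using assms(1) unfolding rooted_tree_def by auto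
  moreover have "i < j" if "(Inl i, Inl j) \<in> ?E\<^sup>+" for i j
  proof -
    \<comment> \<open>The endpoints become variables so that the induction can vary the last vertex.
      A path never runs through a leaf: the source of an edge into \<open>Inl j\<close> is
      \<open>Inl (p j)\<close>.\<close>
    have "x = Inl i \<Longrightarrow> y = Inl j \<Longrightarrow> i < j" if "(x, y) \<in> ?E\<^sup>+" for x y
      using that
    proof (induction arbitrary: j rule: trancl_induct)
      case (base y)
      then have "j \<in> {2..n}" "i = p j" by (auto simp: tree_edges_Inl_iff)
      then show ?case using rec_trees_bounds[OF assms(2)] by simp
    next
      case (step y z)
      then have j: "j \<in> {2..n}" and y: "y = Inl (p j)" by (auto simp: tree_edges_Inl_iff)
      have "i < p j" by (rule step.IH) (use step.prems y in auto)
      then show ?case using rec_trees_bounds[OF assms(2) j] by simp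
    qed
    with that show ?thesis by blast
  qed
  moreover have "children (Inl 1, ?E) (Inr v) = {}" for v
    by (auto simp: children_def tree_edges_def)
  ultimately show ?thesis
    using assms(1) by (auto simp: increasing_trees_def tree_of_def)
qed

text \<open>Leaves have no children, so every parent is internal and can be recorded by its label;
  the increasing condition then gives \<open>p v < v\<close>.\<close>

lemma increasing_tree_eq_tree_of:
  fixes V :: "'v set"
  assumes "T \<in> increasing_trees n V"
  obtains p \<pi> where "p \<in> rec_trees n" "\<pi> \<in> V \<rightarrow>\<^sub>E {1..n}" "T = tree_of n V p \<pi>"
proof -
  let ?W = "{1..n} <+> V"
  obtain r E where T: "T = (r, E)" by (cases T)
  have rt: "rooted_tree ?W r E" and r: "r \<in> Inl ` {1..n}"
    and leaf: "\<And>v. v \<in> V \<Longrightarrow> children (r, E) (Inr v) = {}"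
    and inc: "\<And>i j. (Inl i, Inl j) \<in> E\<^sup>+ \<Longrightarrow> i < j"
    using assms unfolding T increasing_trees_def by auto
  have sub: "E \<subseteq> ?W \<times> ?W" and noroot: "\<And>u. (u, r) \<notin> E"
    and uniq: "\<And>w. w \<in> ?W - {r} \<Longrightarrow> \<exists>!u. (u, w) \<in> E"
    and reach: "\<And>w. w \<in> ?W \<Longrightarrow> (r, w) \<in> E\<^sup>*"
    using rt unfolding rooted_tree_def by auto
  obtain i where i: "r = Inl i" "i \<in> {1..n}" using r by auto
  \<comment> \<open>A root \<open>i\<close> other than 1 would be joined to 1 by a nonempty path,
    forcing \<open>i < 1\<close>.\<close>
  have "r = Inl 1"
  proof (rule ccontr)
    assume "r \<noteq> Inl 1"
    moreover have "(r, Inl 1) \<in> E\<^sup>*" by (rule reach) (use i in auto)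
    ultimately have "(Inl i, Inl 1) \<in> E\<^sup>+" using i by (metis rtranclD)
    from inc[OF this] i show False by simp
  qed
  have internal: "\<exists>i\<in>{1..n}. u = Inl i" if "(u, w) \<in> E" for u w
  proof -
    have "u \<in> ?W" using sub that by auto
    then show ?thesis
    proof
      fix l assume "l \<in> V" "u = Inr l"
      then show ?thesis using leaf[of l] that by (auto simp: children_def)
    qed auto
  qed
  have ex1: "\<exists>!i. (Inl i, w) \<in> E" if "w \<in> ?W - {Inl 1}" for w
  proof -
    have ex: "\<exists>!u. (u, w) \<in> E" using uniq[of w] that \<open>r = Inl 1\<close> by auto
    then obtain u where u: "(u, w) \<in> E" by blast
    with internal[OF u] obtain i where "(Inl i, w) \<in> E" by blast
    with ex show ?thesis by blast
  qed
  \<comment> \<open>Both functions are \<open>undefined\<close> off their domains, as membership in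
    the extensional function sets demands.\<close>
  define p where "p = (\<lambda>v\<in>{2..n}. THE i. (Inl i, Inl v) \<in> E)"
  define \<pi> where "\<pi> = (\<lambda>l\<in>V. THE i. (Inl i, Inr l) \<in> E)"
  have p: "(u, Inl v) \<in> E \<longleftrightarrow> u = Inl (p v)" if "v \<in> {2..n}" for u v
  proof -
    have ex: "\<exists>!i. (Inl i, Inl v) \<in> E" by (rule ex1) (use that in auto)
    have "(Inl (p v), Inl v) \<in> E" using theI'[OF ex] that by (simp add: p_def)
    with ex internal[of u "Inl v"] show ?thesis by blast
  qed
  have \<pi>: "(u, Inr l) \<in> E \<longleftrightarrow> u = Inl (\<pi> l)" if "l \<in> V" for u l
  proof -
    have ex: "\<exists>!i. (Inl i, Inr l) \<in> E" by (rule ex1) (use that in auto)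
    have "(Inl (\<pi> l), Inr l) \<in> E" using theI'[OF ex] that by (simp add: \<pi>_def)
    with ex internal[of u "Inr l"] show ?thesis by blast
  qed
  have "p v \<in> {1..<v}" if v: "v \<in> {2..n}" for v
  proof -
    have e: "(Inl (p v), Inl v) \<in> E" using p[OF v] by blast
    with internal[OF e] inc[of "p v" v] show ?thesis by auto
  qed
  then have "p \<in> rec_trees n"
    unfolding rec_trees_def by (intro PiE_I) (auto simp: p_def)
  moreover have "\<pi> \<in> V \<rightarrow>\<^sub>E {1..n}"
  proof (rule PiE_I)
    fix l assume l: "l \<in> V"
    have e: "(Inl (\<pi> l), Inr l) \<in> E" using \<pi>[OF l] by blast
    with internal[OF e] show "\<pi> l \<in> {1..n}" by auto
  qed (simp add: \<pi>_def)
  moreover have "E = tree_edges n V p \<pi>"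
  proof (rule set_eqI)
    fix e :: "(nat + 'v) \<times> (nat + 'v)"
    obtain u w where e: "e = (u, w)" by (cases e)
    show "e \<in> E \<longleftrightarrow> e \<in> tree_edges n V p \<pi>"
    proof (cases w)
      case (Inl v)
      have "v \<in> {2..n}" if "(u, Inl v) \<in> E"
      proof -
        have "v \<in> {1..n}" using sub that by auto
        moreover have "v \<noteq> 1" using noroot that \<open>r = Inl 1\<close> by auto
        ultimately show ?thesis by auto
      qed
      then show ?thesis unfolding e Inl tree_edges_Inl_iff using p by blast
    next
      case (Inr l)
      have "l \<in> V" if "(u, Inr l) \<in> E" using sub that by auto
      then show ?thesis unfolding e Inr tree_edges_Inr_iff using \<pi> by blast
    qed
  qed
  ultimately show ?thesis
    using that T \<open>r = Inl 1\<close> by (simp add: tree_of_def)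
qed

text \<open>The edges determine the parents on the domains, and extensionality fixes the functions
  elsewhere.\<close>

lemma tree_of_inject:
  assumes "p \<in> rec_trees n" "p' \<in> rec_trees n" "\<pi> \<in> V \<rightarrow>\<^sub>E A" "\<pi>' \<in> V \<rightarrow>\<^sub>E A"
    and "tree_of n V p \<pi> = tree_of n V p' \<pi>'"
  shows "p = p'" "\<pi> = \<pi>'"
proof -
  have E: "tree_edges n V p \<pi> = tree_edges n V p' \<pi>'"
    using assms(5) by (simp add: tree_of_def)
  have "p v = p' v" if "v \<in> {2..n}" for v
    using tree_edges_Inl_iff[of "Inl (p v)" v n V p \<pi>] that
    unfolding E tree_edges_Inl_iff by simp
  with assms(1,2) show "p = p'" unfolding rec_trees_def by (rule PiE_ext)
  have "\<pi> l = \<pi>' l" if "l \<in> V" for l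
    using tree_edges_Inr_iff[of "Inl (\<pi> l)" l n V p \<pi>] that
    unfolding E tree_edges_Inr_iff by simp
  with assms(3,4) show "\<pi> = \<pi>'" by (rule PiE_ext)
qed

text \<open>A leaf lies one level below its parent, so prescribing its height restricts
  \<open>\<pi> l\<close> to one level of the tree; these are the same ranges as in the expansion of
  the coefficient.\<close>

lemma colored_increasing_trees_eq:
  assumes "1 \<le> n"
  shows "colored_increasing_trees n V \<kappa> = (\<lambda>(p, \<pi>). tree_of n V p \<pi>) `
    (SIGMA p:rec_trees n. \<Pi>\<^sub>E l\<in>V. {v \<in> {1..n}. Suc (depth p v) = \<kappa> l})" (is "?L = ?f ` ?R")
proof (intro equalityI subsetI)
  fix T assume T: "T \<in> ?L"
  then have "T \<in> increasing_trees n V" by (simp add: colored_increasing_trees_def)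
  then obtain p \<pi> where *: "p \<in> rec_trees n" "\<pi> \<in> V \<rightarrow>\<^sub>E {1..n}" "T = tree_of n V p \<pi>"
    by (rule increasing_tree_eq_tree_of)
  have "Suc (depth p (\<pi> l)) = \<kappa> l" if "l \<in> V" for l
    using T * that height_tree_of_leaf[of p n l V \<pi>] PiE_mem[OF *(2) that]
    by (auto simp: colored_increasing_trees_def)
  then have "\<pi> \<in> (\<Pi>\<^sub>E l\<in>V. {v \<in> {1..n}. Suc (depth p v) = \<kappa> l})"
    using *(2) unfolding PiE_iff by auto
  with * show "T \<in> ?f ` ?R" by auto
next
  fix T assume "T \<in> ?f ` ?R"
  then obtain p \<pi> where *: "p \<in> rec_trees n"
      "\<pi> \<in> (\<Pi>\<^sub>E l\<in>V. {v \<in> {1..n}. Suc (depth p v) = \<kappa> l})" "T = tree_of n V p \<pi>"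
    by auto
  then have \<pi>: "\<pi> \<in> V \<rightarrow>\<^sub>E {1..n}" unfolding PiE_iff by auto
  have "height T (Inr l) = \<kappa> l" if "l \<in> V" for l
    using height_tree_of_leaf[of p n l V \<pi>] that PiE_mem[OF *(2) that] *(1,3) by simp
  then show "T \<in> ?L"
    using tree_of_in_increasing_trees[OF assms *(1) \<pi>] *(3)
    by (simp add: colored_increasing_trees_def)
qed

lemma finite_colored_increasing_trees:
  assumes "1 \<le> n" "finite V"
  shows "finite (colored_increasing_trees n V \<kappa>)"
  unfolding colored_increasing_trees_eq[OF assms(1)]
  using assms(2) finite_rec_trees by (intro finite_imageI finite_SigmaI finite_PiE) auto

lemma T_coeff_eq_sum_trees:
  assumes "1 \<le> n" "finite V" "\<kappa> ` V \<subseteq> {1..n}"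
  shows "T_coeff \<phi> n V \<kappa> = (\<Sum>T\<in>colored_increasing_trees n V \<kappa>.
    \<Prod>v=1..n. q_const (fps_egf_coeff \<phi> (card (children T (Inl v)))) * q_var (height T (Inl v)))"
proof -
  let ?A = "\<lambda>p. \<Pi>\<^sub>E l\<in>V. {v \<in> {1..n}. Suc (depth p v) = \<kappa> l}"
  let ?w = "\<lambda>T. \<Prod>v=1..n. q_const (fps_egf_coeff \<phi> (card (children T (Inl v)))) *
    q_var (height T (Inl v))"
  have inj: "inj_on (\<lambda>(p, \<pi>). tree_of n V p \<pi>) (Sigma (rec_trees n) ?A)"
  proof (intro inj_onI, clarify)
    fix p p' \<pi> \<pi>'
    assume *: "p \<in> rec_trees n" "p' \<in> rec_trees n" "\<pi> \<in> ?A p" "\<pi>' \<in> ?A p'"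
      "tree_of n V p \<pi> = tree_of n V p' \<pi>'"
    \<comment> \<open>The ranges of the two functions depend on \<open>p\<close> and
      \<open>p'\<close>, so both are first placed in the common range from 1 to
      \<open>n\<close>.\<close>
    then have "\<pi> \<in> V \<rightarrow>\<^sub>E {1..n}" "\<pi>' \<in> V \<rightarrow>\<^sub>E {1..n}"
      unfolding PiE_iff by auto
    from tree_of_inject[OF *(1,2) this *(5)] show "p = p' \<and> \<pi> = \<pi>'" by simp
  qed
  have "T_coeff \<phi> n V \<kappa> = (\<Sum>p\<in>rec_trees n. \<Sum>\<pi>\<in>?A p. ?w (tree_of n V p \<pi>))"
    unfolding T_coeff_expand[OF assms]
    by (intro sum.cong prod.cong refl)
      (simp add: card_children_tree_of[OF assms(2)] height_tree_of_internal)
  also have "\<dots> = (\<Sum>(p, \<pi>)\<in>Sigma (rec_trees n) ?A. ?w (tree_of n V p \<pi>))"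
    using assms(2) by (intro sum.Sigma finite_rec_trees ballI finite_PiE) auto
  also have "\<dots> = (\<Sum>T\<in>colored_increasing_trees n V \<kappa>. ?w T)"
    unfolding colored_increasing_trees_eq[OF assms(1)] sum.reindex[OF inj]
    by (simp add: case_prod_unfold)
  finally show ?thesis .
qed

section \<open>Coefficients in the height variables\<close>

text \<open>The weight of a tree is a single term whose exponents count the vertices at each height,
  so taking a coefficient amounts to selecting trees.\<close>

lemma prod_q_const_q_var:
  assumes "finite I"
  shows "(\<Prod>v\<in>I. q_const (a v) * q_var (h v)) =
    Poly_Mapping.single (\<Sum>v\<in>I. Poly_Mapping.single (h v) 1) (\<Prod>v\<in>I. a v)"
  using assms by (induction I) (simp_all add: q_const_def q_var_def mult_single)

lemma lookup_height_monom:
  "finite I \<Longrightarrow> Poly_Mapping.lookup (\<Sum>v\<in>I. Poly_Mapping.single (h v) (1::nat)) r = card {v \<in> I. h v = r}"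
  by (simp add: lookup_sum lookup_single when_def sum.If_cases Int_def)

text \<open>Only the exponents of q_1, ..., q_{n-1} carry information: vertex 1 alone has height 0,
  and no height exceeds \<open>n - 1\<close>.\<close>

lemma height_monom_eq_iff:
  assumes "1 \<le> n" "p \<in> rec_trees n"
  shows "(\<Sum>v=1..n. Poly_Mapping.single (depth p v) 1) =
      Poly_Mapping.single 0 1 + (\<Sum>r=1..n-1. Poly_Mapping.single r (j r)) \<longleftrightarrow>
    (\<forall>r\<in>{1..n-1}. card {v \<in> {1..n}. depth p v = r} = j r)" (is "?M = ?N \<longleftrightarrow> ?P")
proof -
  have M: "Poly_Mapping.lookup ?M r = card {v \<in> {1..n}. depth p v = r}" for r
    by (rule lookup_height_monom) simp
  have N: "Poly_Mapping.lookup ?N r = (if r = 0 then 1 else if r \<in> {1..n-1} then j r else 0)" for r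
    by (auto simp: lookup_add lookup_single lookup_sum_single when_def)
  have root: "{v \<in> {1..n}. depth p v = 0} = {1}"
  proof -
    have "v = 1" if "v \<in> {1..n}" "depth p v = 0" for v
      using depth_parent[OF assms(2), of v] that by (cases "v = 1") auto
    then show ?thesis using assms(1) by (auto simp: depth_1)
  qed
  have high: "{v \<in> {1..n}. depth p v = r} = {}" if "r \<noteq> 0" "r \<notin> {1..n-1}" for r
  proof -
    have "depth p v \<le> n - 1" if "v \<in> {1..n}" for v
      using depth_le[of p v] that by auto
    with that show ?thesis by fastforce
  qed
  show ?thesis
  proof
    assume "?M = ?N"
    show ?P
    proof
      fix r assume "r \<in> {1..n-1}"
      then show "card {v \<in> {1..n}. depth p v = r} = j r"
        using N[of r] unfolding \<open>?M = ?N\<close>[symmetric] M by simp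
    qed
  next
    assume P: ?P
    show "?M = ?N"
    proof (rule poly_mapping_eqI)
      fix r
      show "Poly_Mapping.lookup ?M r = Poly_Mapping.lookup ?N r"
        unfolding M N using root high[of r] P by (cases "r = 0"; cases "r \<in> {1..n-1}") simp_all
    qed
  qed
qed

lemma lookup_T_coeff:
  assumes "1 \<le> n" "finite V" "\<kappa> ` V \<subseteq> {1..n}"
  shows "Poly_Mapping.lookup (T_coeff \<phi> n V \<kappa>)
      (Poly_Mapping.single 0 1 + (\<Sum>r=1..n-1. Poly_Mapping.single r (j r))) =
    (\<Sum>T | T \<in> colored_increasing_trees n V \<kappa> \<and>
          (\<forall>r\<in>{1..n-1}. card {v \<in> {1..n}. height T (Inl v) = r} = j r).
       \<Prod>v=1..n. fps_egf_coeff \<phi> (card (children T (Inl v))))"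
proof -
  let ?a = "\<lambda>T. \<Prod>v=1..n. fps_egf_coeff \<phi> (card (children T (Inl v)))"
  let ?P = "\<lambda>T. \<forall>r\<in>{1..n-1}. card {v \<in> {1..n}. height T (Inl v) = r} = j r"
  let ?N = "Poly_Mapping.single 0 1 + (\<Sum>r=1..n-1. Poly_Mapping.single r (j r))"
  have iff: "(\<Sum>v=1..n. Poly_Mapping.single (height T (Inl v)) 1) = ?N \<longleftrightarrow> ?P T"
    if T: "T \<in> colored_increasing_trees n V \<kappa>" for T
  proof -
    have "T \<in> increasing_trees n V" using T by (simp add: colored_increasing_trees_def)
    then obtain p \<pi> where p: "p \<in> rec_trees n" and T: "T = tree_of n V p \<pi>"
      by (rule increasing_tree_eq_tree_of)
    have h: "height T (Inl v) = depth p v" if "v \<in> {1..n}" for v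
      unfolding T by (rule height_tree_of_internal[OF p that])
    have "(\<Sum>v=1..n. Poly_Mapping.single (height T (Inl v)) (1::nat)) =
        (\<Sum>v=1..n. Poly_Mapping.single (depth p v) 1)"
      by (intro sum.cong refl) (simp add: h)
    moreover have "{v \<in> {1..n}. height T (Inl v) = r} = {v \<in> {1..n}. depth p v = r}" for r
      using h by auto
    ultimately show ?thesis
      using height_monom_eq_iff[OF assms(1) p, of j] by simp
  qed
  have "Poly_Mapping.lookup (T_coeff \<phi> n V \<kappa>) ?N =
      (\<Sum>T\<in>colored_increasing_trees n V \<kappa>. if ?P T then ?a T else 0)"
    unfolding T_coeff_eq_sum_trees[OF assms] prod_q_const_q_var[OF finite_atLeastAtMost]
      lookup_sum lookup_single when_def
    by (rule sum.cong[OF refl]) (simp only: iff)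
  also have "\<dots> = (\<Sum>T | T \<in> colored_increasing_trees n V \<kappa> \<and> ?P T. ?a T)"
    by (rule sum.inter_filter[symmetric, OF finite_colored_increasing_trees[OF assms(1,2)]])
  finally show ?thesis .
qed

theorem proposition2:
  fixes \<iota> :: "rat \<Rightarrow> 'a::comm_ring_1" and \<phi> :: "'a fps" and n :: nat
  assumes "inj \<iota>" "\<iota> 1 = 1"
    and "\<And>x y. \<iota> (x + y) = \<iota> x + \<iota> y" "\<And>x y. \<iota> (x * y) = \<iota> x * \<iota> y"
    and "n \<ge> 1"
  shows "(\<forall>m. mfps_nth (T_series \<phi> n) m \<noteq> 0 \<longrightarrow> Poly_Mapping.keys m \<subseteq> {1..n}) \<and>
    (\<forall>m. \<forall>p\<in>Poly_Mapping.keys (mfps_nth (T_series \<phi> n) m). Poly_Mapping.keys p \<subseteq> {0..n-1}) \<and>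
    (\<forall>(V :: 'v set) \<kappa>. finite V \<and> \<kappa> ` V \<subseteq> {1..n} \<longrightarrow>
      T_coeff \<phi> n V \<kappa> =
        (\<Sum>T\<in>colored_increasing_trees n V \<kappa>.
           \<Prod>v=1..n. q_const (fps_egf_coeff \<phi> (card (children T (Inl v))))
                    * q_var (height T (Inl v))) \<and>
      (\<forall>j :: nat \<Rightarrow> nat.
        Poly_Mapping.lookup (T_coeff \<phi> n V \<kappa>)
          (Poly_Mapping.single 0 1 + (\<Sum>r=1..n-1. Poly_Mapping.single r (j r))) =
        (\<Sum>T | T \<in> colored_increasing_trees n V \<kappa> \<and>
              (\<forall>r\<in>{1..n-1}. card {v \<in> {1..n}. height T (Inl v) = r} = j r).
           \<Prod>v=1..n. fps_egf_coeff \<phi> (card (children T (Inl v))))))"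
proof (intro conjI allI ballI impI)
  fix m assume "mfps_nth (T_series \<phi> n) m \<noteq> 0"
  \<comment> \<open>\<open>supported_in\<close> speaks about the q-monomials of a coefficient; a
    nonzero coefficient has at least one.\<close>
  then obtain p where "p \<in> Poly_Mapping.keys (mfps_nth (T_series \<phi> n) m)"
    using keys_eq_empty by blast
  then show "Poly_Mapping.keys m \<subseteq> {1..n}"
    using supported_in_T_series[OF \<open>n \<ge> 1\<close>, of \<phi>] unfolding supported_in_def by blast
next
  fix m p assume "p \<in> Poly_Mapping.keys (mfps_nth (T_series \<phi> n) m)"
  then show "Poly_Mapping.keys p \<subseteq> {0..n-1}"
    using supported_in_T_series[OF \<open>n \<ge> 1\<close>, of \<phi>] unfolding supported_in_def by blast
qed (rule T_coeff_eq_sum_trees lookup_T_coeff; use \<open>n \<ge> 1\<close> in blast)+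

end
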